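(* Let $p,\hat k\in\mathbb Z^2\setminus\{0\}$ with $\hat k+np\neq0$ for all $n\in\mathbb Z$, let $\Gamma=\Gamma_r+i\Gamma_i\in\mathbb C$, and let $\mathcal L$ be the linear operator on $\ell_2\times\ell_2$ defined by $\mathcal L(\alpha,\beta)^T=(\xi,\eta)^T$, where for $n\in\mathbb Z$ $$\xi_n=\kappa\big[\rho_{n+1}\Gamma_r\alpha_{n+1}-\rho_{n-1}\Gamma_r\alpha_{n-1}+\rho_{n+1}\Gamma_i\beta_{n+1}+\rho_{n-1}\Gamma_i\beta_{n-1}\big],$$ $$\eta_n=-\kappa\big[\rho_{n-1}\Gamma_r\beta_{n-1}-\rho_{n+1}\Gamma_r\beta_{n+1}+\rho_{n+1}\Gamma_i\alpha_{n+1}+\rho_{n-1}\Gamma_i\alpha_{n-1}\big].$$ Then: 1. The eigenvalues of $\mathcal L$ are of four types: real pairs $(c,-c)$, purely imaginary pairs $(id,-id)$, quadruples $(\pm c\pm id)$, and zero eigenvalues. (That is, if $\lambda$ is an eigenvalue then so are $\bar\lambda$ and $-\lambda$.) 2. If $\lambda$ is a real eigenvalue, then $\lambda$ is a multiple eigenvalue. If $\lambda$ is a simple non-real eigenvalue, then its corresponding eigenvector $(\alpha,\beta)^T$ satisfies $\beta=i\alpha$ or $\beta=-i\alpha$. 3. If $\Sigma_{\hat k}\cap\bar D_{|p|}=\emptyset$, then all the eigenvalues of $\mathcal L$ are either purely imaginary and in complex conjugate pairs ($\lambda=ic,-ic$ with $c$ real and nonzero) or zeros. 4. If $|\hat k|=|p|$,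 then zero is a multiple eigenvalue of $\mathcal L$. 5. If $|\hat k|=|p|$ and $\hat k+p\notin\bar D_{|p|}$ (respectively $\hat k-p\notin\bar D_{|p|}$), then all the eigenvalues of the half system $\mathcal L^+$ (respectively $\mathcal L^-$) are either purely imaginary and in complex conjugate pairs or zeros.
   Context: Notation: $\rho_n=|\hat k+np|^{-2}-|p|^{-2}$; $\kappa=\frac12(\hat k_1p_2-\hat k_2p_1)$; $\Sigma_{\hat k}=\{\hat k+np\in\mathbb Z^2\setminus\{0\}:n\in\mathbb Z\}$; $\bar D_{|p|}=\{k\in\mathbb Z^2\setminus\{0\}:|k|\le|p|\}$. Here $\alpha=(\alpha_n)_{n\in\mathbb Z}$ and $\beta=(\beta_n)_{n\in\mathbb Z}$ are in $\ell_2$. A number $\lambda\in\mathbb C$ is an eigenvalue if there is a nonzero complex $(\alpha,\beta)^T\in\ell_2\times\ell_2$ with $\mathcal L(\alpha,\beta)^T=\lambda(\alpha,\beta)^T$; it is simple if its eigenspace is one-dimensional and multiple if there are at least two linearly independent eigenvectors. (With $\omega_{\hat k+np}=\alpha_n+i\beta_n$, the equation $(\dot\alpha,\dot\beta)^T=\mathcal L(\alpha,\beta)^T$ is an invariant subsystem of the linearized 2D Euler equation.) When $|\hat k|=|p|$ we have $\rho_0=0$, so the equations with $n\ge1$ involve only the variables with index $\ge1$, and those with $n\le-1$ involve only the variables with index $\le-1$. $\mathcal L^+$ denotes the operator $(\alpha_n,\beta_n)_{n\ge1}\mapsto(\xi_n,\eta_n)_{n\ge1}$ on $\ell_2\times\ell_2$,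 and $\mathcal L^-$ denotes $(\alpha_n,\beta_n)_{n\le-1}\mapsto(\xi_n,\eta_n)_{n\le-1}$, given by the same formulas. Their eigenvalues are defined in the same way. *)

theory Defs
  imports "HOL-Analysis.Analysis" "HOL-Library.Function_Algebras"
begin

text \<open>Points of the lattice are pairs of integers; their length is the Euclidean norm of
  the corresponding point of \<^typ>\<open>real \<times> real\<close>.\<close>

definition lnorm :: "int \<times> int \<Rightarrow> real" where
  "lnorm k = norm (real_of_int (fst k), real_of_int (snd k))"

definition shift :: "int \<times> int \<Rightarrow> int \<times> int \<Rightarrow> int \<Rightarrow> int \<times> int" where
  "shift k p n = (fst k + n * fst p, snd k + n * snd p)"

definition rho :: "int \<times> int \<Rightarrow> int \<times> int \<Rightarrow> int \<Rightarrow> real" where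
  "rho k p n = lnorm (shift k p n) powi (-2) - lnorm p powi (-2)"

definition kappa :: "int \<times> int \<Rightarrow> int \<times> int \<Rightarrow> real" where
  "kappa k p = (1/2) * (real_of_int (fst k) * real_of_int (snd p)
                        - real_of_int (snd k) * real_of_int (fst p))"

definition Sigma_class :: "int \<times> int \<Rightarrow> int \<times> int \<Rightarrow> (int \<times> int) set" where
  "Sigma_class k p = {shift k p n | n. shift k p n \<noteq> 0}"

definition Dbar :: "int \<times> int \<Rightarrow> (int \<times> int) set" where
  "Dbar p = {k. k \<noteq> 0 \<and> lnorm k \<le> lnorm p}"

type_synonym seq2 = "(int \<Rightarrow> complex) \<times> (int \<Rightarrow> complex)"

text \<open>Square-summable complex sequences indexed by a set of integers, extended by zero
  outside the index set.\<close>

definition ell2 :: "int set \<Rightarrow> (int \<Rightarrow> complex) set" where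
  "ell2 I = {a. (\<forall>n. n \<notin> I \<longrightarrow> a n = 0) \<and> (\<lambda>n. (cmod (a n))\<^sup>2) summable_on I}"

definition cscale :: "complex \<Rightarrow> seq2 \<Rightarrow> seq2" where
  "cscale c v = ((\<lambda>n. c * fst v n), (\<lambda>n. c * snd v n))"

global_interpretation seq2: vector_space cscale
  by standard
     (auto simp: cscale_def fun_eq_iff prod_eq_iff algebra_simps)

definition xi_comp :: "int \<times> int \<Rightarrow> int \<times> int \<Rightarrow> complex \<Rightarrow> seq2 \<Rightarrow> int \<Rightarrow> complex" where
  "xi_comp k p \<Gamma> v n = (let a = fst v; b = snd v; r = (\<lambda>m. complex_of_real (rho k p m));
      Gr = complex_of_real (Re \<Gamma>); Gi = complex_of_real (Im \<Gamma>) in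
    complex_of_real (kappa k p) *
      (r (n+1) * Gr * a (n+1) - r (n-1) * Gr * a (n-1)
       + r (n+1) * Gi * b (n+1) + r (n-1) * Gi * b (n-1)))"

definition eta_comp :: "int \<times> int \<Rightarrow> int \<times> int \<Rightarrow> complex \<Rightarrow> seq2 \<Rightarrow> int \<Rightarrow> complex" where
  "eta_comp k p \<Gamma> v n = (let a = fst v; b = snd v; r = (\<lambda>m. complex_of_real (rho k p m));
      Gr = complex_of_real (Re \<Gamma>); Gi = complex_of_real (Im \<Gamma>) in
    - complex_of_real (kappa k p) *
      (r (n-1) * Gr * b (n-1) - r (n+1) * Gr * b (n+1)
       + r (n+1) * Gi * a (n+1) + r (n-1) * Gi * a (n-1)))"

text \<open>The operator given by these formulas at the indices in \<open>I\<close>: the full operator for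
  \<open>I = UNIV\<close>, the half systems for \<open>I = {1..}\<close> and \<open>I = {..-1}\<close>.\<close>

definition Lop :: "int set \<Rightarrow> int \<times> int \<Rightarrow> int \<times> int \<Rightarrow> complex \<Rightarrow> seq2 \<Rightarrow> seq2" where
  "Lop I k p \<Gamma> v = ((\<lambda>n. if n \<in> I then xi_comp k p \<Gamma> v n else 0),
                    (\<lambda>n. if n \<in> I then eta_comp k p \<Gamma> v n else 0))"

abbreviation Lfull :: "int \<times> int \<Rightarrow> int \<times> int \<Rightarrow> complex \<Rightarrow> seq2 \<Rightarrow> seq2" where
  "Lfull \<equiv> Lop UNIV"

abbreviation Lplus :: "int \<times> int \<Rightarrow> int \<times> int \<Rightarrow> complex \<Rightarrow> seq2 \<Rightarrow> seq2" where
  "Lplus \<equiv> Lop {1..}"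

abbreviation Lminus :: "int \<times> int \<Rightarrow> int \<times> int \<Rightarrow> complex \<Rightarrow> seq2 \<Rightarrow> seq2" where
  "Lminus \<equiv> Lop {..-1}"

definition eigenspace :: "int set \<Rightarrow> (seq2 \<Rightarrow> seq2) \<Rightarrow> complex \<Rightarrow> seq2 set" where
  "eigenspace I T \<mu> = {v \<in> ell2 I \<times> ell2 I. T v = cscale \<mu> v}"

definition eigenvector :: "int set \<Rightarrow> (seq2 \<Rightarrow> seq2) \<Rightarrow> complex \<Rightarrow> seq2 \<Rightarrow> bool" where
  "eigenvector I T \<mu> v \<longleftrightarrow> v \<in> eigenspace I T \<mu> \<and> v \<noteq> 0"

definition eigenvalue :: "int set \<Rightarrow> (seq2 \<Rightarrow> seq2) \<Rightarrow> complex \<Rightarrow> bool" where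
  "eigenvalue I T \<mu> \<longleftrightarrow> (\<exists>v. eigenvector I T \<mu> v)"

definition simple_eigenvalue :: "int set \<Rightarrow> (seq2 \<Rightarrow> seq2) \<Rightarrow> complex \<Rightarrow> bool" where
  "simple_eigenvalue I T \<mu> \<longleftrightarrow> eigenvalue I T \<mu> \<and> seq2.dim (eigenspace I T \<mu>) = 1"

definition multiple_eigenvalue :: "int set \<Rightarrow> (seq2 \<Rightarrow> seq2) \<Rightarrow> complex \<Rightarrow> bool" where
  "multiple_eigenvalue I T \<mu> \<longleftrightarrow>
     (\<exists>u v. eigenvector I T \<mu> u \<and> eigenvector I T \<mu> v \<and> u \<noteq> v \<and> seq2.independent {u, v})"

lemma Lop_linear: "Vector_Spaces.linear cscale cscale (Lop I k p \<Gamma>)"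
  by unfold_locales
     (auto simp: Lop_def xi_comp_def eta_comp_def cscale_def Let_def fun_eq_iff
        prod_eq_iff algebra_simps)

lemma lnorm_ge_1:
  assumes "k \<noteq> 0"
  shows "1 \<le> lnorm k"
proof -
  have "fst k \<noteq> 0 \<or> snd k \<noteq> 0"
    using assms by (auto simp: prod_eq_iff)
  then have "1 \<le> \<bar>real_of_int (fst k)\<bar> \<or> 1 \<le> \<bar>real_of_int (snd k)\<bar>"
    by linarith
  moreover have "\<bar>real_of_int (fst k)\<bar> \<le> lnorm k" "\<bar>real_of_int (snd k)\<bar> \<le> lnorm k"
    using real_sqrt_sum_squares_ge1[of "\<bar>real_of_int (fst k)\<bar>" "real_of_int (snd k)"]
      real_sqrt_sum_squares_ge2[of "\<bar>real_of_int (snd k)\<bar>" "real_of_int (fst k)"]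
    by (auto simp: lnorm_def norm_Pair)
  ultimately show ?thesis by linarith
qed

lemma abs_rho_le_1:
  assumes "p \<noteq> 0" and "shift k p n \<noteq> 0"
  shows "\<bar>rho k p n\<bar> \<le> 1"
proof -
  have *: "0 \<le> x powi (-2) \<and> x powi (-2) \<le> 1" if "1 \<le> x" for x :: real
    using that by (auto simp: power_int_def field_simps)
  show ?thesis
    using *[OF lnorm_ge_1[OF assms(1)]] *[OF lnorm_ge_1[OF assms(2)]]
    unfolding rho_def by linarith
qed

lemma ell2_add:
  assumes "a \<in> ell2 I" "b \<in> ell2 I"
  shows "(\<lambda>n. a n + b n) \<in> ell2 I"
proof -
  have "(\<lambda>n. 2 * (cmod (a n))\<^sup>2 + 2 * (cmod (b n))\<^sup>2) summable_on I"
    using assms by (intro summable_on_add summable_on_cmult_right) (auto simp: ell2_def)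
  then have "(\<lambda>n. (cmod (a n + b n))\<^sup>2) summable_on I"
  proof (rule summable_on_comparison_test)
    fix n
    have "(cmod (a n + b n))\<^sup>2 \<le> (cmod (a n) + cmod (b n))\<^sup>2"
      by (intro power_mono norm_triangle_ineq) auto
    also have "\<dots> \<le> 2 * (cmod (a n))\<^sup>2 + 2 * (cmod (b n))\<^sup>2"
      using sum_squares_bound[of "cmod (a n)" "cmod (b n)"] by (simp add: power2_sum)
    finally show "(cmod (a n + b n))\<^sup>2 \<le> 2 * (cmod (a n))\<^sup>2 + 2 * (cmod (b n))\<^sup>2" .
  qed auto
  then show ?thesis using assms by (auto simp: ell2_def)
qed

lemma ell2_mult:
  assumes "a \<in> ell2 I" and "\<And>n. cmod (c n) \<le> B"
  shows "(\<lambda>n. c n * a n) \<in> ell2 I"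
proof -
  have "(\<lambda>n. B\<^sup>2 * (cmod (a n))\<^sup>2) summable_on I"
    using assms by (intro summable_on_cmult_right) (auto simp: ell2_def)
  then have "(\<lambda>n. (cmod (c n * a n))\<^sup>2) summable_on I"
    by (rule summable_on_comparison_test)
       (auto simp: norm_mult power_mult_distrib intro!: mult_right_mono power_mono assms(2))
  then show ?thesis using assms by (auto simp: ell2_def)
qed

lemma ell2_extend: "a \<in> ell2 I \<Longrightarrow> a \<in> ell2 UNIV"
  unfolding ell2_def by (auto elim!: summable_on_cong_neutral[THEN iffD1, rotated -1])

lemma ell2_restrict: "a \<in> ell2 UNIV \<Longrightarrow> (\<lambda>n. if n \<in> I then a n else 0) \<in> ell2 I"
proof -
  assume "a \<in> ell2 UNIV"
  then have "(\<lambda>n. (cmod (a n))\<^sup>2) summable_on I"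
    by (auto simp: ell2_def intro: summable_on_subset_banach)
  then show ?thesis
    by (auto simp: ell2_def cong: summable_on_cong)
qed

lemma ell2_translate:
  assumes "a \<in> ell2 UNIV"
  shows "(\<lambda>n. a (n + m)) \<in> ell2 UNIV"
proof -
  have "bij (\<lambda>n::int. n + m)"
    by (rule bij_betw_byWitness[where f' = "\<lambda>n. n - m"]) auto
  from summable_on_reindex_bij_betw[OF this, of "\<lambda>n. (cmod (a n))\<^sup>2"] assms
  show ?thesis by (auto simp: ell2_def)
qed

lemma Lop_ell2:
  assumes "p \<noteq> 0" "\<And>n. shift k p n \<noteq> 0" and v: "v \<in> ell2 I \<times> ell2 I"
  shows "Lop I k p \<Gamma> v \<in> ell2 I \<times> ell2 I"
proof -
  have shifted: "(\<lambda>n. c * complex_of_real (rho k p (n + m)) * w (n + m)) \<in> ell2 UNIV"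
    if "w \<in> ell2 I" for c w m
  proof -
    have "cmod (c * complex_of_real (rho k p n)) \<le> cmod c" for n
      using mult_left_mono[OF abs_rho_le_1[OF assms(1,2), of n], of "cmod c"]
      by (simp add: norm_mult)
    from ell2_translate[OF ell2_mult[OF ell2_extend[OF that] this], where m = m]
    show ?thesis by (simp add: mult.assoc)
  qed
  obtain a b where ab: "v = (a, b)" "a \<in> ell2 I" "b \<in> ell2 I" using v by auto
  let ?r = "\<lambda>m. complex_of_real (rho k p m)" and ?K = "complex_of_real (kappa k p)"
    and ?Gr = "complex_of_real (Re \<Gamma>)" and ?Gi = "complex_of_real (Im \<Gamma>)"
  have xi: "xi_comp k p \<Gamma> v = (\<lambda>n. ?K * ?Gr * ?r (n + 1) * a (n + 1)
      + (- ?K * ?Gr * ?r (n + -1) * a (n + -1)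
      + (?K * ?Gi * ?r (n + 1) * b (n + 1) + ?K * ?Gi * ?r (n + -1) * b (n + -1))))"
    by (auto simp: xi_comp_def Let_def ab(1) fun_eq_iff algebra_simps)
  have eta: "eta_comp k p \<Gamma> v = (\<lambda>n. - ?K * ?Gr * ?r (n + -1) * b (n + -1)
      + (?K * ?Gr * ?r (n + 1) * b (n + 1)
      + (- ?K * ?Gi * ?r (n + 1) * a (n + 1) + - ?K * ?Gi * ?r (n + -1) * a (n + -1))))"
    by (auto simp: eta_comp_def Let_def ab(1) fun_eq_iff algebra_simps)
  have "xi_comp k p \<Gamma> v \<in> ell2 UNIV" "eta_comp k p \<Gamma> v \<in> ell2 UNIV"
    unfolding xi eta by (intro ell2_add shifted ab)+
  then show ?thesis
    using ell2_restrict unfolding Lop_def by auto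
qed

text \<open>For \<open>rho k p 0 = 0\<close> the restricted formulas do not depend on the entries outside the
  half line, so the extension by zero in \<^const>\<open>ell2\<close> is immaterial.\<close>

lemma half_system_decouples:
  assumes "lnorm k = lnorm p" and I: "I = {1..} \<or> I = {..-1}"
    and "\<And>n. n \<in> I \<Longrightarrow> fst v n = fst w n" "\<And>n. n \<in> I \<Longrightarrow> snd v n = snd w n"
  shows "Lop I k p \<Gamma> v = Lop I k p \<Gamma> w"
proof -
  have "rho k p 0 = 0" using assms(1) by (simp add: rho_def shift_def)
  then have "rho k p m = 0 \<or> (fst v m = fst w m \<and> snd v m = snd w m)"
    if "n \<in> I" "m = n + 1 \<or> m = n - 1" for n m
    using that I assms(3,4)[of m] by (cases "m = 0") auto
  then have "rho k p (n + 1) = 0 \<or> (fst v (n + 1) = fst w (n + 1) \<and> snd v (n + 1) = snd w (n + 1))"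
    "rho k p (n - 1) = 0 \<or> (fst v (n - 1) = fst w (n - 1) \<and> snd v (n - 1) = snd w (n - 1))"
    if "n \<in> I" for n
    using that by blast+
  then have "xi_comp k p \<Gamma> v n = xi_comp k p \<Gamma> w n \<and> eta_comp k p \<Gamma> v n = eta_comp k p \<Gamma> w n"
    if "n \<in> I" for n
    using that unfolding xi_comp_def eta_comp_def Let_def
    by (smt (verit) mult_zero_left of_real_0)
  then show ?thesis
    by (simp add: Lop_def fun_eq_iff)
qed

end

theory Submission
  imports Defs
begin

text \<open>The operator has real coefficients, anticommutes with the multiplication by \<open>(-1)\<^sup>n\<close>,
  and commutes with \<open>J (\<alpha>, \<beta>) = (-\<beta>, \<alpha>)\<close>; the first two facts give the symmetries of the
  spectrum. If an eigenvector \<open>v\<close> is not an eigenvector of \<open>J\<close>, then \<open>v\<close> and \<open>J v\<close> are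
  independent; otherwise \<open>J v = \<plusminus>\<i> v\<close>, and the conjugate of \<open>v\<close> belongs to the other
  eigenvalue of \<open>J\<close>. Finally, \<open>w = \<alpha> \<plusminus> \<i>\<beta>\<close> satisfies a three-term recurrence; multiplying it
  by \<open>\<rho>\<^sub>n\<close> times the conjugate of \<open>w\<^sub>n\<close> and taking real parts, the right-hand side telescopes,
  so \<open>Re \<lambda> * (\<Sum>n. \<rho>\<^sub>n |w\<^sub>n|\<^sup>2) = 0\<close>, which forces \<open>Re \<lambda> = 0\<close> when all \<open>\<rho>\<^sub>n\<close> are negative.\<close>

section \<open>The eigenvalue equation read entry by entry\<close>

lemma eigenvectorI:
  assumes "a \<in> ell2 I" "b \<in> ell2 I" "(a, b) \<noteq> 0"
    and "\<And>n. n \<in> I \<Longrightarrow> xi_comp k p \<Gamma> (a, b) n = \<mu> * a n"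
    and "\<And>n. n \<in> I \<Longrightarrow> eta_comp k p \<Gamma> (a, b) n = \<mu> * b n"
  shows "eigenvector I (Lop I k p \<Gamma>) \<mu> (a, b)"
  using assms by (auto simp: eigenvector_def eigenspace_def Lop_def cscale_def ell2_def fun_eq_iff)

lemma eigenvectorD:
  assumes "eigenvector I (Lop I k p \<Gamma>) \<mu> (a, b)"
  shows "a \<in> ell2 I" "b \<in> ell2 I" "(a, b) \<noteq> 0"
    and "n \<in> I \<Longrightarrow> xi_comp k p \<Gamma> (a, b) n = \<mu> * a n"
    and "n \<in> I \<Longrightarrow> eta_comp k p \<Gamma> (a, b) n = \<mu> * b n"
proof -
  have *: "(if n \<in> I then xi_comp k p \<Gamma> (a, b) n else 0) = \<mu> * a n"
    "(if n \<in> I then eta_comp k p \<Gamma> (a, b) n else 0) = \<mu> * b n" for n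
    using assms by (auto simp: eigenvector_def eigenspace_def Lop_def cscale_def fun_eq_iff)
  show "a \<in> ell2 I" "b \<in> ell2 I" "(a, b) \<noteq> 0"
    using assms by (auto simp: eigenvector_def eigenspace_def)
  show "n \<in> I \<Longrightarrow> xi_comp k p \<Gamma> (a, b) n = \<mu> * a n"
    "n \<in> I \<Longrightarrow> eta_comp k p \<Gamma> (a, b) n = \<mu> * b n"
    using *[of n] by simp_all
qed

section \<open>Symmetries of the operator: conjugation, alternating signs, rotation\<close>

lemma ell2_cnj: "a \<in> ell2 I \<Longrightarrow> (\<lambda>n. cnj (a n)) \<in> ell2 I"
  by (simp add: ell2_def)

lemma ell2_scale: "a \<in> ell2 I \<Longrightarrow> (\<lambda>n. c * a n) \<in> ell2 I"
  by (rule ell2_mult[where B = "cmod c"]) auto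

lemma eigenvector_cnj:
  assumes "eigenvector I (Lop I k p \<Gamma>) \<mu> (a, b)"
  shows "eigenvector I (Lop I k p \<Gamma>) (cnj \<mu>) ((\<lambda>n. cnj (a n)), (\<lambda>n. cnj (b n)))"
proof (rule eigenvectorI)
  note v = eigenvectorD[OF assms]
  show "(\<lambda>n. cnj (a n)) \<in> ell2 I" "(\<lambda>n. cnj (b n)) \<in> ell2 I"
    using v by (auto intro: ell2_cnj)
  show "((\<lambda>n. cnj (a n)), (\<lambda>n. cnj (b n))) \<noteq> 0"
    using v(3) by (auto simp: fun_eq_iff zero_prod_def)
  fix n assume n: "n \<in> I"
  show "xi_comp k p \<Gamma> ((\<lambda>n. cnj (a n)), (\<lambda>n. cnj (b n))) n = cnj \<mu> * cnj (a n)"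
    using arg_cong[OF v(4)[OF n], of cnj] by (simp add: xi_comp_def Let_def)
  show "eta_comp k p \<Gamma> ((\<lambda>n. cnj (a n)), (\<lambda>n. cnj (b n))) n = cnj \<mu> * cnj (b n)"
    using arg_cong[OF v(5)[OF n], of cnj] by (simp add: eta_comp_def Let_def)
qed

lemma eigenvalue_cnj:
  "eigenvalue I (Lop I k p \<Gamma>) \<mu> \<Longrightarrow> eigenvalue I (Lop I k p \<Gamma>) (cnj \<mu>)"
  by (metis eigenvalue_def eigenvector_cnj surj_pair)

lemma eigenvalue_uminus:
  assumes "eigenvalue I (Lop I k p \<Gamma>) \<mu>"
  shows "eigenvalue I (Lop I k p \<Gamma>) (- \<mu>)"
proof -
  obtain a b where ab: "eigenvector I (Lop I k p \<Gamma>) \<mu> (a, b)"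
    using assms by (auto simp: eigenvalue_def)
  note v = eigenvectorD[OF ab]
  \<comment> \<open>This is the sequence of signs (-1)^n, written through parity because n may be
    negative. Each row n involves only the entries n - 1 and n + 1, whose sign is opposite to that
    of n.\<close>
  define s :: "int \<Rightarrow> complex" where "s n = (if even n then 1 else - 1)" for n
  have s: "s (1 + n) = - s n" "s (n - 1) = - s n" "cmod (s n) \<le> 1" "s n \<noteq> 0" for n
    by (auto simp: s_def)
  have "eigenvector I (Lop I k p \<Gamma>) (- \<mu>) ((\<lambda>n. s n * a n), (\<lambda>n. s n * b n))"
  proof (rule eigenvectorI)
    show "(\<lambda>n. s n * a n) \<in> ell2 I" "(\<lambda>n. s n * b n) \<in> ell2 I"
      using v s(3) by (auto intro: ell2_mult)
    show "((\<lambda>n. s n * a n), (\<lambda>n. s n * b n)) \<noteq> 0"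
      using v(3) s(4) by (auto simp: fun_eq_iff zero_prod_def)
    fix n assume n: "n \<in> I"
    have "xi_comp k p \<Gamma> ((\<lambda>n. s n * a n), (\<lambda>n. s n * b n)) n = - s n * xi_comp k p \<Gamma> (a, b) n"
      by (simp add: xi_comp_def Let_def s(1,2) algebra_simps)
    then show "xi_comp k p \<Gamma> ((\<lambda>n. s n * a n), (\<lambda>n. s n * b n)) n = - \<mu> * (s n * a n)"
      by (simp add: v(4)[OF n])
    have "eta_comp k p \<Gamma> ((\<lambda>n. s n * a n), (\<lambda>n. s n * b n)) n = - s n * eta_comp k p \<Gamma> (a, b) n"
      by (simp add: eta_comp_def Let_def s(1,2) algebra_simps)
    then show "eta_comp k p \<Gamma> ((\<lambda>n. s n * a n), (\<lambda>n. s n * b n)) n = - \<mu> * (s n * b n)"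
      by (simp add: v(5)[OF n])
  qed
  then show ?thesis
    by (auto simp: eigenvalue_def)
qed

text \<open>For real sequences this rotation is multiplication by i of the mode \<alpha> + i
  \<beta>. The equations are complex linear in that mode, so the rotation exchanges the two rows up
  to sign.\<close>

lemma eigenvector_rotate:
  assumes "eigenvector I (Lop I k p \<Gamma>) \<mu> (a, b)"
  shows "eigenvector I (Lop I k p \<Gamma>) \<mu> ((\<lambda>n. - b n), a)"
proof (rule eigenvectorI)
  note v = eigenvectorD[OF assms]
  show "(\<lambda>n. - b n) \<in> ell2 I"
    using ell2_scale[OF v(2), of "- 1"] by simp
  show "a \<in> ell2 I" by (rule v)
  show "((\<lambda>n. - b n), a) \<noteq> 0"
    using v(3) by (auto simp: fun_eq_iff zero_prod_def)
  fix n assume n: "n \<in> I"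
  have "xi_comp k p \<Gamma> ((\<lambda>n. - b n), a) n = - eta_comp k p \<Gamma> (a, b) n"
    by (simp add: xi_comp_def eta_comp_def Let_def algebra_simps)
  then show "xi_comp k p \<Gamma> ((\<lambda>n. - b n), a) n = \<mu> * - b n"
    by (simp add: v(5)[OF n])
  have "eta_comp k p \<Gamma> ((\<lambda>n. - b n), a) n = xi_comp k p \<Gamma> (a, b) n"
    by (simp add: xi_comp_def eta_comp_def Let_def algebra_simps)
  then show "eta_comp k p \<Gamma> ((\<lambda>n. - b n), a) n = \<mu> * a n"
    by (simp add: v(4)[OF n])
qed

section \<open>Multiplicity and polarization of eigenvectors\<close>

lemma multiple_eigenvalueI:
  assumes "eigenvector I T \<mu> u" "eigenvector I T \<mu> v" and nc: "\<And>c. v \<noteq> cscale c u"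
  shows "multiple_eigenvalue I T \<mu>"
proof -
  have "u \<noteq> v"
    \<comment> \<open>Distinctness has to be recorded separately: for equal vectors
      \<open>{u, v}\<close> would collapse to an independent singleton.\<close>
    using nc[of 1] by (auto simp: cscale_def)
  moreover have "u \<noteq> 0"
    using assms(1) by (simp add: eigenvector_def)
  moreover have "v \<notin> seq2.span {u}"
    using nc by (auto simp: seq2.span_breakdown_eq)
  ultimately have "seq2.independent {v, u}"
    by (simp add: seq2.independent_insert)
  with assms \<open>u \<noteq> v\<close> show ?thesis
    unfolding multiple_eigenvalue_def by (metis insert_commute)
qed

text \<open>Simplicity is defined by \<open>dim\<close> and multiplicity by an explicit pair. The
  bridge is that the span of one basis vector has no room for two independent vectors.\<close>

lemma multiple_not_simple_eigenvalue:
  assumes "multiple_eigenvalue I T \<mu>"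
  shows "\<not> simple_eigenvalue I T \<mu>"
proof
  assume "simple_eigenvalue I T \<mu>"
  then have dim: "seq2.dim (eigenspace I T \<mu>) = 1"
    by (simp add: simple_eigenvalue_def)
  obtain u v where uv: "u \<in> eigenspace I T \<mu>" "v \<in> eigenspace I T \<mu>" "u \<noteq> v"
    "seq2.independent {u, v}"
    using assms by (auto simp: multiple_eigenvalue_def eigenvector_def)
  obtain B where B: "eigenspace I T \<mu> \<subseteq> seq2.span B" "card B = 1"
    using seq2.basis_exists[of "eigenspace I T \<mu>"] dim by metis
  \<comment> \<open>An infinite set has \<open>card\<close> 0, so cardinality 1 forces
    finiteness.\<close>
  then have "finite B"
    using card.infinite by fastforce
  moreover have "{u, v} \<subseteq> seq2.span B"
    using uv B by auto
  ultimately have "card {u, v} \<le> card B"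
    using seq2.independent_span_bound uv(4) by blast
  then show False
    using uv(3) B by simp
qed

text \<open>Either the rotated eigenvector is a second independent one, or the vector is an
  eigenvector of the rotation. The rotation squares to minus the identity, so its factor
  \<open>c\<close> satisfies \<open>c * c = - 1\<close>.\<close>

lemma multiple_or_polarized:
  assumes "eigenvector I (Lop I k p \<Gamma>) \<mu> (a, b)"
  shows "multiple_eigenvalue I (Lop I k p \<Gamma>) \<mu> \<or> (\<forall>n. b n = \<i> * a n) \<or> (\<forall>n. b n = - \<i> * a n)"
proof (cases "\<exists>c. ((\<lambda>n. - b n), a) = cscale c (a, b)")
  case True
  then obtain c where "((\<lambda>n. - b n), a) = cscale c (a, b)" by blast
  then have c: "- b n = c * a n" "a n = c * b n" for n
    unfolding cscale_def prod.inject fst_conv snd_conv by metis+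
  obtain m where "a m \<noteq> 0 \<or> b m \<noteq> 0"
    using eigenvectorD(3)[OF assms] by (auto simp: fun_eq_iff zero_prod_def)
  then have "a m \<noteq> 0" using c(2)[of m] c(1)[of m] by auto
  moreover have "a m = - (c * c) * a m"
    using c(1)[of m] c(2)[of m] by (metis mult.assoc mult_minus_left mult_minus_right minus_minus)
  ultimately have "c * c = - 1"
    by (metis equation_minus_iff mult_cancel_right1)
  then have "(c - \<i>) * (c + \<i>) = 0"
    by (simp add: algebra_simps)
  then have "c = \<i> \<or> c = - \<i>"
    by (auto simp: eq_neg_iff_add_eq_0)
  moreover have "b n = - c * a n" for n
    using arg_cong[OF c(1)[of n], of uminus] by simp
  ultimately show ?thesis by auto
next
  case False
  then show ?thesis
    using multiple_eigenvalueI[OF assms eigenvector_rotate[OF assms]] by auto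
qed

text \<open>Conjugation keeps a real eigenvalue fixed but swaps the polarizations \<beta> = i
  \<alpha> and \<beta> = -i \<alpha>, so a polarized eigenvector and its conjugate are
  independent.\<close>

lemma real_eigenvalue_multiple:
  assumes "eigenvalue I (Lop I k p \<Gamma>) \<mu>" "\<mu> \<in> \<real>"
  shows "multiple_eigenvalue I (Lop I k p \<Gamma>) \<mu>"
proof (rule ccontr)
  assume nm: "\<not> ?thesis"
  obtain a b where ab: "eigenvector I (Lop I k p \<Gamma>) \<mu> (a, b)"
    using assms by (auto simp: eigenvalue_def)
  obtain e where e: "b n = e * a n" "e = \<i> \<or> e = - \<i>" for n
    using multiple_or_polarized[OF ab] nm by metis
  obtain m where m: "a m \<noteq> 0"
    using eigenvectorD(3)[OF ab] e by (auto simp: fun_eq_iff zero_prod_def)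
  have "eigenvector I (Lop I k p \<Gamma>) \<mu> ((\<lambda>n. cnj (a n)), (\<lambda>n. cnj (b n)))"
    using eigenvector_cnj[OF ab] assms(2) by (simp add: Reals_cnj_iff)
  moreover have "((\<lambda>n. cnj (a n)), (\<lambda>n. cnj (b n))) \<noteq> cscale c (a, b)" for c
  proof
    assume "((\<lambda>n. cnj (a n)), (\<lambda>n. cnj (b n))) = cscale c (a, b)"
    then have "cnj (a m) = c * a m" "cnj (b m) = c * b m"
      by (auto simp: cscale_def fun_eq_iff)
    \<comment> \<open>Substituting \<open>b m = e * a m\<close> and eliminating \<open>c\<close>
      would make \<open>e\<close> equal to its own conjugate, impossible for i and -i.\<close>
    then have "cnj e * cnj (a m) = e * cnj (a m)"
      by (simp add: e(1) algebra_simps)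
    with m e(2) show False
      by (auto simp: complex_eq_iff)
  qed
  ultimately show False
    using multiple_eigenvalueI[OF ab] nm by blast
qed

text \<open>Entries at index 0 enter the operator only with the factor \<open>rho k p 0\<close>, so
  the unit sequence at 0 lies in the kernel. As 0 is real, this one eigenvector already yields
  multiplicity.\<close>

lemma zero_multiple_eigenvalue:
  assumes "rho k p 0 = 0"
  shows "multiple_eigenvalue UNIV (Lfull k p \<Gamma>) 0"
proof -
  let ?d = "(\<lambda>n. if n = 0 then 1 else 0) :: int \<Rightarrow> complex"
  have "(\<lambda>n. (cmod (?d n))\<^sup>2) summable_on UNIV"
    by (rule summable_on_cong_neutral[THEN iffD1, of _ "{0}"]) auto
  then have d: "?d \<in> ell2 UNIV"
    by (simp add: ell2_def)
  have "eigenvector UNIV (Lfull k p \<Gamma>) 0 (?d, 0)"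
  proof (rule eigenvectorI)
    show "(?d, 0) \<noteq> 0"
      by (auto simp: zero_prod_def fun_eq_iff)
  qed (use d in \<open>auto simp: ell2_def xi_comp_def eta_comp_def assms\<close>)
  then show ?thesis
    by (intro real_eigenvalue_multiple) (auto simp: eigenvalue_def)
qed

section \<open>Telescoping energy identity and purely imaginary spectrum\<close>

lemma summable_mult_neighbour:
  assumes w: "w \<in> ell2 UNIV" and r: "\<And>n. \<bar>r n\<bar> \<le> (1::real)"
  shows "(\<lambda>n. Re (C * (r n * cnj (w n) * (r (n + 1) * w (n + 1))))) summable_on UNIV"
proof -
  \<comment> \<open>The majorant comes from |r| at most 1 and 2xy at most x^2 + y^2 for neighbouring
    entries.\<close>
  have "(\<lambda>n. cmod C * ((cmod (w n))\<^sup>2 + (cmod (w (n + 1)))\<^sup>2)) summable_on UNIV"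
    using w ell2_translate[OF w, of 1]
    by (intro summable_on_cmult_right summable_on_add) (auto simp: ell2_def)
  moreover have "norm (Re (C * (r n * cnj (w n) * (r (n + 1) * w (n + 1)))))
      \<le> cmod C * ((cmod (w n))\<^sup>2 + (cmod (w (n + 1)))\<^sup>2)" for n
  proof -
    have le: "cmod (r m * x) \<le> cmod x" for m and x :: complex
      using mult_right_mono[OF r[of m], of "cmod x"] by (simp add: norm_mult)
    have "norm (Re (C * (r n * cnj (w n) * (r (n + 1) * w (n + 1)))))
        \<le> cmod C * (cmod (r n * cnj (w n)) * cmod (r (n + 1) * w (n + 1)))"
      by (metis abs_Re_le_cmod norm_mult real_norm_def)
    also have "\<dots> \<le> cmod C * (cmod (w n) * cmod (w (n + 1)))"
      using le[of n "cnj (w n)"] le[of "n + 1" "w (n + 1)"]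
      by (intro mult_left_mono mult_mono) auto
    also have "\<dots> \<le> cmod C * ((cmod (w n))\<^sup>2 + (cmod (w (n + 1)))\<^sup>2)"
    proof (rule mult_left_mono)
      have "2 * (cmod (w n) * cmod (w (n + 1))) \<le> (cmod (w n))\<^sup>2 + (cmod (w (n + 1)))\<^sup>2"
        using sum_squares_bound[of "cmod (w n)" "cmod (w (n + 1))"] by simp
      moreover have "0 \<le> cmod (w n) * cmod (w (n + 1))" by simp
      ultimately show "cmod (w n) * cmod (w (n + 1)) \<le> (cmod (w n))\<^sup>2 + (cmod (w (n + 1)))\<^sup>2"
        by linarith
    qed simp
    finally show ?thesis .
  qed
  ultimately show ?thesis
    by (rule abs_summable_summable[OF Infinite_Sum.abs_summable_on_comparison_test'])
qed

text \<open>Stated for an arbitrary index set \<open>I\<close> and coefficient \<open>G\<close>, so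
  that it serves the full system, both half systems and both polarizations. Sequences vanish off
  \<open>I\<close>, so the sums may run over all integers.\<close>

lemma negative_recurrence_trivial:
  assumes w: "w \<in> ell2 I" and r: "\<And>n. \<bar>r n\<bar> \<le> (1::real)" and neg: "\<And>n. n \<in> I \<Longrightarrow> r n < 0"
    and rec: "\<And>n. n \<in> I \<Longrightarrow> \<mu> * w n = of_real K * (cnj G * r (n + 1) * w (n + 1) - G * r (n - 1) * w (n - 1))"
    and nz: "Re \<mu> \<noteq> 0"
  shows "w n = 0"
proof -
  \<comment> \<open>\<open>f n\<close> is the flux between n and n + 1; the sign in \<open>e\<close>
    below makes the weighted energy nonnegative.\<close>
  define f where "f n = Re (of_real K * cnj G * (r n * cnj (w n) * (r (n + 1) * w (n + 1))))" for n
  define e where "e n = - r n * (cmod (w n))\<^sup>2" for n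
  have out: "w n = 0" if "n \<notin> I" for n
    using w that by (simp add: ell2_def)
  have f: "f summable_on UNIV"
    unfolding f_def by (rule summable_mult_neighbour[OF ell2_extend[OF w] r])
  have bij: "bij (\<lambda>n::int. n - 1)"
    by (rule bij_betw_byWitness[where f' = "\<lambda>n. n + 1"]) auto
  \<comment> \<open>Translating the index does not change the sum over all integers, so the flux
    differences sum to 0.\<close>
  have "((\<lambda>n. f (n - 1)) has_sum infsum f UNIV) UNIV"
    unfolding has_sum_reindex_bij_betw[OF bij, of f] by (rule has_sum_infsum[OF f])
  from has_sum_add[OF this has_sum_uminusI[OF has_sum_infsum[OF f]]]
  have d: "((\<lambda>n. f (n - 1) - f n) has_sum 0) UNIV"
    by simp
  have tele: "Re \<mu> * e n = f (n - 1) - f n" for n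
  proof (cases "n \<in> I")
    case False
    then show ?thesis by (simp add: out e_def f_def)
  next
    case True
    \<comment> \<open>The recurrence at n multiplied by \<open>- r n * cnj (w n)\<close>.\<close>
    have "of_real (- r n) * cnj (w n) * (\<mu> * w n) =
        of_real K * G * (r n * cnj (w n) * (r (n - 1) * w (n - 1)))
        - of_real K * cnj G * (r n * cnj (w n) * (r (n + 1) * w (n + 1)))"
      unfolding rec[OF True] by (simp add: algebra_simps)
    moreover have "of_real (- r n) * cnj (w n) * (\<mu> * w n) = of_real (e n) * \<mu>"
      using complex_norm_square[of "w n"] by (simp add: e_def algebra_simps)
    \<comment> \<open>Since \<open>K\<close> and \<open>r\<close> are real, the backward coupling at
      n is the conjugate of the forward coupling at n - 1, and so has the same real part.\<close>
    moreover have "Re (of_real K * G * (r n * cnj (w n) * (r (n - 1) * w (n - 1)))) = f (n - 1)"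
    proof -
      have "cnj (of_real K * cnj G * (r (n - 1) * cnj (w (n - 1)) * (r n * w n)))
        = of_real K * G * (r n * cnj (w n) * (r (n - 1) * w (n - 1)))"
        by (simp add: algebra_simps)
      then show ?thesis
        unfolding f_def by (metis complex_cnj(1) cnj.simps(1) diff_add_cancel)
    qed
    ultimately have "Re (of_real (e n) * \<mu>) = f (n - 1) - f n"
      by (simp only: f_def minus_complex.simps)
    then show ?thesis by (simp add: mult.commute)
  qed
  have e_eq: "e = (\<lambda>n. (f (n - 1) - f n) * (1 / Re \<mu>))"
    using tele nz by (auto simp: fun_eq_iff field_simps)
  have "(e has_sum 0) UNIV"
    unfolding e_eq using has_sum_cmult_left[OF d, of "1 / Re \<mu>"] by simp
  then have "e summable_on UNIV" "infsum e UNIV = 0"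
    by (auto simp: summable_on_def infsumI)
  moreover have nonneg: "0 \<le> e n" for n
    using neg[of n] out[of n] by (cases "n \<in> I") (auto simp: e_def mult_nonpos_nonneg)
  ultimately have "e n = 0"
    by (intro nonneg_infsum_le_0D[of e UNIV]) auto
  then show ?thesis
    using neg[of n] out[of n] by (cases "n \<in> I") (auto simp: e_def)
qed

text \<open>The combinations \<alpha> + i \<beta> and \<alpha> - i \<beta> decouple, the second
  obeying the recurrence with \<open>cnj \<Gamma>\<close>. Since \<alpha> and \<beta> are complex,
  both combinations must vanish before the eigenvector does.\<close>

lemma eigenvalue_Re_zero:
  assumes "p \<noteq> 0" "\<forall>n. shift k p n \<noteq> 0" and neg: "\<And>n. n \<in> I \<Longrightarrow> rho k p n < 0"
    and "eigenvalue I (Lop I k p \<Gamma>) \<mu>"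
  shows "Re \<mu> = 0"
proof (rule ccontr)
  assume nz: "Re \<mu> \<noteq> 0"
  obtain a b where ab: "eigenvector I (Lop I k p \<Gamma>) \<mu> (a, b)"
    using assms(4) by (auto simp: eigenvalue_def)
  note v = eigenvectorD[OF ab]
  have r: "\<bar>rho k p n\<bar> \<le> 1" for n
    using assms by (intro abs_rho_le_1) auto
  obtain x y where \<Gamma>: "\<Gamma> = Complex x y" by (cases \<Gamma>)
  have "a n + \<i> * b n = 0" for n
  proof (rule negative_recurrence_trivial[where w = "\<lambda>n. a n + \<i> * b n" and r = "rho k p", OF _ r neg _ nz])
    show "(\<lambda>n. a n + \<i> * b n) \<in> ell2 I"
      using v by (intro ell2_add ell2_scale)
    fix n assume n: "n \<in> I"
    have "\<mu> * (a n + \<i> * b n) = xi_comp k p \<Gamma> (a, b) n + \<i> * eta_comp k p \<Gamma> (a, b) n"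
      by (simp add: v(4,5)[OF n] algebra_simps)
    then show "\<mu> * (a n + \<i> * b n) = of_real (kappa k p) *
      (cnj \<Gamma> * rho k p (n + 1) * (a (n + 1) + \<i> * b (n + 1))
       - \<Gamma> * rho k p (n - 1) * (a (n - 1) + \<i> * b (n - 1)))"
      by (simp add: xi_comp_def eta_comp_def Let_def \<Gamma> Complex_eq algebra_simps)
  qed
  moreover have "a n + (- \<i>) * b n = 0" for n
  proof (rule negative_recurrence_trivial[where w = "\<lambda>n. a n + (- \<i>) * b n" and r = "rho k p" and G = "cnj \<Gamma>",
        OF _ r neg _ nz])
    show "(\<lambda>n. a n + (- \<i>) * b n) \<in> ell2 I"
      using v by (intro ell2_add ell2_scale)
    fix n assume n: "n \<in> I"
    have "\<mu> * (a n + (- \<i>) * b n) = xi_comp k p \<Gamma> (a, b) n - \<i> * eta_comp k p \<Gamma> (a, b) n"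
      by (simp add: v(4,5)[OF n] algebra_simps)
    then show "\<mu> * (a n + (- \<i>) * b n) = of_real (kappa k p) *
      (cnj (cnj \<Gamma>) * rho k p (n + 1) * (a (n + 1) + (- \<i>) * b (n + 1))
       - cnj \<Gamma> * rho k p (n - 1) * (a (n - 1) + (- \<i>) * b (n - 1)))"
      by (simp add: xi_comp_def eta_comp_def Let_def \<Gamma> Complex_eq algebra_simps)
  qed
  ultimately have "a n = 0 \<and> b n = 0" for n
    unfolding complex_eq_iff by (smt (verit) Re_i_times Im_i_times plus_complex.simps
        mult_minus_left uminus_complex.simps zero_complex.simps)
  then show False
    using v(3) by (auto simp: zero_prod_def fun_eq_iff)
qed

text \<open>On the imaginary axis conjugation is negation, so \<open>eigenvalue_uminus\<close>
  supplies the other member of the pair.\<close>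

lemma imaginary_eigenvalue:
  assumes "p \<noteq> 0" "\<forall>n. shift k p n \<noteq> 0" "\<And>n. n \<in> I \<Longrightarrow> rho k p n < 0"
    and "eigenvalue I (Lop I k p \<Gamma>) \<mu>"
  shows "\<mu> = 0 \<or> (\<exists>c::real. c \<noteq> 0 \<and> \<mu> = \<i> * of_real c
           \<and> eigenvalue I (Lop I k p \<Gamma>) (- (\<i> * of_real c)))"
proof -
  have "\<mu> = \<i> * of_real (Im \<mu>)"
    using eigenvalue_Re_zero[OF assms] by (simp add: complex_eq_iff)
  then show ?thesis
    using eigenvalue_uminus[OF assms(4)] by (metis mult_zero_right of_real_0)
qed

section \<open>The four types of eigenvalues\<close>

lemma eigenvalue_types:
  assumes "eigenvalue I (Lop I k p \<Gamma>) \<mu>"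
  shows "\<mu> = 0
    \<or> (\<exists>c::real. c \<noteq> 0 \<and> \<mu> = of_real c \<and> eigenvalue I (Lop I k p \<Gamma>) (- of_real c))
    \<or> (\<exists>d::real. d \<noteq> 0 \<and> \<mu> = \<i> * of_real d \<and> eigenvalue I (Lop I k p \<Gamma>) (- (\<i> * of_real d)))
    \<or> (\<exists>c d::real. c \<noteq> 0 \<and> d \<noteq> 0 \<and> \<mu> = of_real c + \<i> * of_real d
        \<and> eigenvalue I (Lop I k p \<Gamma>) (of_real c - \<i> * of_real d)
        \<and> eigenvalue I (Lop I k p \<Gamma>) (- of_real c + \<i> * of_real d)
        \<and> eigenvalue I (Lop I k p \<Gamma>) (- of_real c - \<i> * of_real d))"
proof -
  define c d where "c = Re \<mu>" "d = Im \<mu>"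
  have \<mu>: "\<mu> = of_real c + \<i> * of_real d"
    by (simp add: c_d_def complex_eq_iff)
  have "cnj \<mu> = of_real c - \<i> * of_real d" "- \<mu> = - of_real c - \<i> * of_real d"
    "- cnj \<mu> = - of_real c + \<i> * of_real d"
    by (simp_all add: \<mu>)
  then have ev: "eigenvalue I (Lop I k p \<Gamma>) (of_real c - \<i> * of_real d)"
    "eigenvalue I (Lop I k p \<Gamma>) (- of_real c - \<i> * of_real d)"
    "eigenvalue I (Lop I k p \<Gamma>) (- of_real c + \<i> * of_real d)"
    using assms eigenvalue_cnj eigenvalue_uminus by metis+
  consider "c = 0" "d = 0" | "c \<noteq> 0" "d = 0" | "c = 0" "d \<noteq> 0" | "c \<noteq> 0" "d \<noteq> 0" by blast
  then show ?thesis
  proof cases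
    case 1 then show ?thesis using \<mu> by simp
  next
    case 2 then show ?thesis using \<mu> ev(2) by auto
  next
    case 3 then show ?thesis using \<mu> ev(2) by auto
  next
    case 4 then show ?thesis using \<mu> ev by blast
  qed
qed

section \<open>Lattice points outside the disc and the sign of \<open>rho\<close>\<close>

lemma rho_neg:
  assumes "p \<noteq> 0" "lnorm p < lnorm (shift k p n)"
  shows "rho k p n < 0"
proof -
  have "0 < lnorm p" using lnorm_ge_1[OF assms(1)] by simp
  then show ?thesis
    using assms(2) power_strict_mono[OF assms(2), of 2]
    by (simp add: rho_def power_int_minus field_simps)
qed

lemma lnorm_less_iff:
  "lnorm x < lnorm y \<longleftrightarrow> (fst x)\<^sup>2 + (snd x)\<^sup>2 < (fst y)\<^sup>2 + (snd y)\<^sup>2"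
proof -
  have "lnorm x < lnorm y \<longleftrightarrow>
      real_of_int ((fst x)\<^sup>2 + (snd x)\<^sup>2) < real_of_int ((fst y)\<^sup>2 + (snd y)\<^sup>2)"
    by (simp add: lnorm_def norm_Pair)
  then show ?thesis by (simp only: of_int_less_iff)
qed

text \<open>The line through k in direction p meets the disc in a convex set. Starting on the
  boundary and being outside after one step, it cannot return. The sign \<open>s\<close> selects the
  half line.\<close>

lemma shift_leaves_disc:
  assumes eq: "lnorm k = lnorm p" and "\<bar>s\<bar> = 1" and far: "lnorm p < lnorm (shift k p s)" and "1 \<le> m"
  shows "lnorm p < lnorm (shift k p (s * m))"
proof -
  \<comment> \<open>\<open>A\<close> is the common value of |p|^2 and |k|^2, and \<open>B\<close> is
    2s times the inner product of k and p. Then |k + s m p|^2 - |p|^2 = m (B + m A), and the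
    hypothesis \<open>far\<close> is the case m = 1.\<close>
  define A B where "A = (fst p)\<^sup>2 + (snd p)\<^sup>2" "B = 2 * s * (fst k * fst p + snd k * snd p)"
  have k: "(fst k)\<^sup>2 + (snd k)\<^sup>2 = A"
    using lnorm_less_iff[of k p] lnorm_less_iff[of p k] eq unfolding A_B_def by linarith
  have s: "s\<^sup>2 = 1" using assms(2) by (metis power2_abs one_power2)
  have sh: "(fst (shift k p (s * m)))\<^sup>2 + (snd (shift k p (s * m)))\<^sup>2 = A + m * B + m\<^sup>2 * A" for m
  proof -
    have "(fst (shift k p (s * m)))\<^sup>2 + (snd (shift k p (s * m)))\<^sup>2
       = (fst k)\<^sup>2 + (snd k)\<^sup>2 + m * B + s\<^sup>2 * (m\<^sup>2 * A)"
      by (simp add: shift_def A_B_def power2_eq_square algebra_simps)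
    then show ?thesis by (simp only: k s mult_1)
  qed
  have "0 < B + A"
    using far sh[of 1] by (simp add: lnorm_less_iff A_B_def(1))
  moreover have "0 \<le> (m - 1) * A"
    using \<open>1 \<le> m\<close> by (simp add: A_B_def)
  ultimately have "0 < B + m * A"
    by (simp add: algebra_simps)
  then have "0 < m * (B + m * A)"
    using \<open>1 \<le> m\<close> by simp
  then show ?thesis
    unfolding lnorm_less_iff sh by (simp add: A_B_def(1) power2_eq_square algebra_simps)
qed

section \<open>Assembly of the five claims\<close>

theorem mainTheorem2:
  fixes p k :: "int \<times> int" and \<Gamma> :: complex
  assumes "p \<noteq> 0" and "k \<noteq> 0" and "\<forall>n. shift k p n \<noteq> 0"
  shows
    "(\<forall>\<mu>. eigenvalue UNIV (Lfull k p \<Gamma>) \<mu> \<longrightarrow>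
        (eigenvalue UNIV (Lfull k p \<Gamma>) (cnj \<mu>) \<and> eigenvalue UNIV (Lfull k p \<Gamma>) (- \<mu>)) \<and>
        (\<mu> = 0
         \<or> (\<exists>c::real. c \<noteq> 0 \<and> \<mu> = of_real c \<and> eigenvalue UNIV (Lfull k p \<Gamma>) (- of_real c))
         \<or> (\<exists>d::real. d \<noteq> 0 \<and> \<mu> = \<i> * of_real d \<and> eigenvalue UNIV (Lfull k p \<Gamma>) (- (\<i> * of_real d)))
         \<or> (\<exists>c d::real. c \<noteq> 0 \<and> d \<noteq> 0 \<and> \<mu> = of_real c + \<i> * of_real d
              \<and> eigenvalue UNIV (Lfull k p \<Gamma>) (of_real c - \<i> * of_real d)
              \<and> eigenvalue UNIV (Lfull k p \<Gamma>) (- of_real c + \<i> * of_real d)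
              \<and> eigenvalue UNIV (Lfull k p \<Gamma>) (- of_real c - \<i> * of_real d))))
     \<and>
     (\<forall>\<mu>. eigenvalue UNIV (Lfull k p \<Gamma>) \<mu> \<and> \<mu> \<in> \<real> \<longrightarrow> multiple_eigenvalue UNIV (Lfull k p \<Gamma>) \<mu>)
     \<and>
     (\<forall>\<mu> \<alpha> \<beta>. simple_eigenvalue UNIV (Lfull k p \<Gamma>) \<mu> \<and> \<mu> \<notin> \<real>
          \<and> eigenvector UNIV (Lfull k p \<Gamma>) \<mu> (\<alpha>, \<beta>) \<longrightarrow>
        (\<forall>n. \<beta> n = \<i> * \<alpha> n) \<or> (\<forall>n. \<beta> n = - \<i> * \<alpha> n))
     \<and>
     (Sigma_class k p \<inter> Dbar p = {} \<longrightarrow>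
        (\<forall>\<mu>. eigenvalue UNIV (Lfull k p \<Gamma>) \<mu> \<longrightarrow> \<mu> = 0
           \<or> (\<exists>c::real. c \<noteq> 0 \<and> \<mu> = \<i> * of_real c \<and> eigenvalue UNIV (Lfull k p \<Gamma>) (- (\<i> * of_real c)))))
     \<and>
     (lnorm k = lnorm p \<longrightarrow> multiple_eigenvalue UNIV (Lfull k p \<Gamma>) 0)
     \<and>
     (lnorm k = lnorm p \<and> k + p \<notin> Dbar p \<longrightarrow>
        (\<forall>\<mu>. eigenvalue {1..} (Lplus k p \<Gamma>) \<mu> \<longrightarrow> \<mu> = 0
           \<or> (\<exists>c::real. c \<noteq> 0 \<and> \<mu> = \<i> * of_real c
                \<and> eigenvalue {1..} (Lplus k p \<Gamma>) (- (\<i> * of_real c)))))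
     \<and>
     (lnorm k = lnorm p \<and> k - p \<notin> Dbar p \<longrightarrow>
        (\<forall>\<mu>. eigenvalue {..-1} (Lminus k p \<Gamma>) \<mu> \<longrightarrow> \<mu> = 0
           \<or> (\<exists>c::real. c \<noteq> 0 \<and> \<mu> = \<i> * of_real c
                \<and> eigenvalue {..-1} (Lminus k p \<Gamma>) (- (\<i> * of_real c)))))"
proof (intro conjI allI impI; (elim conjE)?)
  note p = assms(1) and sh = assms(3)
  \<comment> \<open>\<open>Dbar\<close> omits the origin, so lying outside it means being far away
    only for nonzero points; \<open>sh\<close> excludes the origin.\<close>
  have not_Dbar: "lnorm p < lnorm (shift k p n)" if "shift k p n \<notin> Dbar p" for n
    using that sh by (auto simp: Dbar_def)
  fix \<mu>
  show "eigenvalue UNIV (Lfull k p \<Gamma>) (cnj \<mu>)" "eigenvalue UNIV (Lfull k p \<Gamma>) (- \<mu>)"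
    if "eigenvalue UNIV (Lfull k p \<Gamma>) \<mu>"
    using that eigenvalue_cnj eigenvalue_uminus by auto
  show "\<mu> = 0
         \<or> (\<exists>c::real. c \<noteq> 0 \<and> \<mu> = of_real c \<and> eigenvalue UNIV (Lfull k p \<Gamma>) (- of_real c))
         \<or> (\<exists>d::real. d \<noteq> 0 \<and> \<mu> = \<i> * of_real d \<and> eigenvalue UNIV (Lfull k p \<Gamma>) (- (\<i> * of_real d)))
         \<or> (\<exists>c d::real. c \<noteq> 0 \<and> d \<noteq> 0 \<and> \<mu> = of_real c + \<i> * of_real d
              \<and> eigenvalue UNIV (Lfull k p \<Gamma>) (of_real c - \<i> * of_real d)
              \<and> eigenvalue UNIV (Lfull k p \<Gamma>) (- of_real c + \<i> * of_real d)
              \<and> eigenvalue UNIV (Lfull k p \<Gamma>) (- of_real c - \<i> * of_real d))"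
    if "eigenvalue UNIV (Lfull k p \<Gamma>) \<mu>"
    using that by (rule eigenvalue_types)
  show "multiple_eigenvalue UNIV (Lfull k p \<Gamma>) \<mu>"
    if "eigenvalue UNIV (Lfull k p \<Gamma>) \<mu>" "\<mu> \<in> \<real>"
    using that by (rule real_eigenvalue_multiple)
  show "(\<forall>n. \<beta> n = \<i> * \<alpha> n) \<or> (\<forall>n. \<beta> n = - \<i> * \<alpha> n)"
    if "simple_eigenvalue UNIV (Lfull k p \<Gamma>) \<mu>" "eigenvector UNIV (Lfull k p \<Gamma>) \<mu> (\<alpha>, \<beta>)" for \<alpha> \<beta>
    using multiple_or_polarized[OF that(2)] multiple_not_simple_eigenvalue that(1) by blast
  show "\<mu> = 0 \<or> (\<exists>c::real. c \<noteq> 0 \<and> \<mu> = \<i> * of_real c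
      \<and> eigenvalue UNIV (Lfull k p \<Gamma>) (- (\<i> * of_real c)))"
    if "Sigma_class k p \<inter> Dbar p = {}" "eigenvalue UNIV (Lfull k p \<Gamma>) \<mu>"
  proof (rule imaginary_eigenvalue[OF p sh _ that(2)])
    fix n
    have "shift k p n \<in> Sigma_class k p"
      using sh by (auto simp: Sigma_class_def)
    then show "rho k p n < 0"
      using that(1) by (intro rho_neg[OF p] not_Dbar) auto
  qed
  show "multiple_eigenvalue UNIV (Lfull k p \<Gamma>) 0" if "lnorm k = lnorm p"
    using that by (intro zero_multiple_eigenvalue) (simp add: rho_def shift_def)
  show "\<mu> = 0 \<or> (\<exists>c::real. c \<noteq> 0 \<and> \<mu> = \<i> * of_real c
      \<and> eigenvalue {1..} (Lplus k p \<Gamma>) (- (\<i> * of_real c)))"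
    if "lnorm k = lnorm p" "k + p \<notin> Dbar p" "eigenvalue {1..} (Lplus k p \<Gamma>) \<mu>"
  proof (rule imaginary_eigenvalue[OF p sh _ that(3)])
    fix n :: int assume n: "n \<in> {1..}"
    have "shift k p 1 = k + p" by (simp add: shift_def prod_eq_iff)
    then show "rho k p n < 0"
      using shift_leaves_disc[of k p 1 n] not_Dbar[of 1] n that(1,2) by (intro rho_neg[OF p]) auto
  qed
  show "\<mu> = 0 \<or> (\<exists>c::real. c \<noteq> 0 \<and> \<mu> = \<i> * of_real c
      \<and> eigenvalue {..-1} (Lminus k p \<Gamma>) (- (\<i> * of_real c)))"
    if "lnorm k = lnorm p" "k - p \<notin> Dbar p" "eigenvalue {..-1} (Lminus k p \<Gamma>) \<mu>"
  proof (rule imaginary_eigenvalue[OF p sh _ that(3)])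
    fix n :: int assume n: "n \<in> {..-1}"
    have "shift k p (- 1) = k - p" by (simp add: shift_def prod_eq_iff)
    then show "rho k p n < 0"
      \<comment> \<open>With s = -1 and m = -n, at least 1, the product s * m is n again.\<close>
      using shift_leaves_disc[of k p "- 1" "- n"] not_Dbar[of "- 1"] n that(1,2)
      by (intro rho_neg[OF p]) auto
  qed
qed

end
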